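(* Let $A\in\mathbb{R}^{m\times n}$, $b\in\mathbb{R}^m$, $p=2$, and let $\phi(z)=z$ for $z\ge 0$. Let $L$ and $s_i,\rho_i,\Omega_i$ ($i\in\mathbb{N}_L^0$) be produced by the iteration described in the context. Let $\sigma^*:=\min\{\|Ax-b\|_2:x\in\mathbb{R}^n\}$, let $\sigma\in[\sigma^*,\|b\|_2)$, and let $\widehat\Omega(\sigma)$ be the set of all global minimizers of the problem $$\min\{\|x\|_0:\|Ax-b\|_2\le\sigma,\ x\in\mathbb{R}^n\}.\qquad(\ast)$$ Then the following statements are equivalent: (i) There exists $k\in\mathbb{N}_{L-1}^0$ such that $\rho_k=\sigma$. (ii) $\|Ax-b\|_2=\sigma$ for any $x\in\widehat\Omega(\sigma)$. (iii) Any $x\in\widehat\Omega(\sigma)$ is a strict minimizer of problem $(\ast)$. (iv) $\widehat\Omega(\sigma)$ has finite cardinality.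
   Context: $\mathbb{N}_k^0=\{0,1,\dots,k\}$; $\|x\|_0$ is the number of nonzero components of $x$; $\arg\min$ denotes the set of all global minimizers. For $x\in\mathbb{R}^d$ and $\delta>0$, $U(x;\delta):=\{x'\in\mathbb{R}^d:\|x-x'\|_2\le\delta\}$. For $g:\mathbb{R}^d\to\mathbb{R}$ and $S\subseteq\mathbb{R}^d$, $\hat x$ is a strict minimizer of $\min\{g(x):x\in S\}$ if there exists $\delta>0$ such that $g(x)>g(\hat x)$ for every $x\in U(\hat x;\delta)\cap S$ with $x\ne\hat x$. Iteration (depending on $A,b,p,\phi$). Set $i=0$ and $\rho_0:=\min\{\phi(\|Ax-b\|_p):x\in\mathbb{R}^n\}$, $s_0:=\min\{\|x\|_0:\phi(\|Ax-b\|_p)=\rho_0,\ x\in\mathbb{R}^n\}$, $\Omega_0:=\arg\min\{\|x\|_0:\phi(\|Ax-b\|_p)=\rho_0,\ x\in\mathbb{R}^n\}$. While $s_i>0$: put $\rho_{i+1}:=\min\{\phi(\|Ax-b\|_p):\|x\|_0\le s_i-1,\ x\in\mathbb{R}^n\}$, $s_{i+1}:=\min\{\|x\|_0:\phi(\|Ax-b\|_p)=\rho_{i+1},\ x\in\mathbb{R}^n\}$, $\Omega_{i+1}:=\arg\min\{\|x\|_0:\phi(\|Ax-b\|_p)=\rho_{i+1},\ x\in\mathbb{R}^n\}$, and replace $i$ by $i+1$. When the loop ends (i.e. $s_i=0$), set $L:=i$. (All these minima are attained and the iteration terminates.) *)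

theory Defs
  imports "HOL-Analysis.Analysis"
begin

definition l0 :: "real ^ 'd \<Rightarrow> nat" where
  "l0 x = card {i. x $ i \<noteq> 0}"

text \<open>The value of a minimisation problem is the least element of the image, and not the infimum:
  it is specified only if the minimum is attained.\<close>

definition min_val :: "('a \<Rightarrow> 'b::linorder) \<Rightarrow> 'a set \<Rightarrow> 'b" where
  "min_val g S = (LEAST y. y \<in> g ` S)"

definition argmin_set :: "('a \<Rightarrow> 'b::linorder) \<Rightarrow> 'a set \<Rightarrow> 'a set" where
  "argmin_set g S = {x. is_arg_min g (\<lambda>x. x \<in> S) x}"

definition strict_minimizer ::
    "(real ^ 'd \<Rightarrow> 'b::linorder) \<Rightarrow> (real ^ 'd) set \<Rightarrow> real ^ 'd \<Rightarrow> bool" where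
  "strict_minimizer g S xh \<longleftrightarrow>
     (\<exists>\<delta>>0. \<forall>x \<in> cball xh \<delta> \<inter> S. x \<noteq> xh \<longrightarrow> g x > g xh)"

text \<open>The iteration is run for an arbitrary objective \<open>f\<close> on \<open>\<real>\<^sup>n\<close>; the intended instances are
  \<open>f x = \<phi> (\<parallel>A x - b\<parallel>)\<close>. The sequences are defined at every index, but only the terms up to
  \<open>iter_L f\<close> belong to the iteration. In particular \<open>iter_s f i - 1\<close> is truncated only when
  \<open>iter_s f i = 0\<close>, i.e. when the loop has already ended.\<close>

function iter_rho :: "(real ^ 'n \<Rightarrow> real) \<Rightarrow> nat \<Rightarrow> real"
  and iter_s :: "(real ^ 'n \<Rightarrow> real) \<Rightarrow> nat \<Rightarrow> nat" where
  "iter_rho f 0 = min_val f UNIV"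
| "iter_rho f (Suc i) = min_val f {x. l0 x \<le> iter_s f i - 1}"
| "iter_s f i = min_val l0 {x. f x = iter_rho f i}"
  by pat_completeness auto
termination
  by (relation "Wellfounded.measure (case_sum (\<lambda>(f, i). 2 * i) (\<lambda>(f, i). 2 * i + 1))") auto

definition iter_Omega :: "(real ^ 'n \<Rightarrow> real) \<Rightarrow> nat \<Rightarrow> (real ^ 'n) set" where
  "iter_Omega f i = argmin_set l0 {x. f x = iter_rho f i}"

definition iter_L :: "(real ^ 'n \<Rightarrow> real) \<Rightarrow> nat" where
  "iter_L f = (LEAST i. iter_s f i = 0)"

end

theory Submission
  imports Defs
begin

text \<open>Only \<open>(ii) \<Longrightarrow> (i)\<close> uses the iteration in depth: as long as \<open>\<rho>\<^sub>i < \<sigma>\<close>, the sparsity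
  \<open>s\<^sub>i\<close> exceeds the optimal sparsity of \<open>(\<ast>)\<close>, which is positive because \<open>\<sigma> < \<parallel>b\<parallel>\<close>; so \<open>\<sigma>\<close> has
  to be hit before the loop ends. For the rest,
  \<open>(ii) \<Longrightarrow> (iv) \<Longrightarrow> (iii) \<Longrightarrow> (ii)\<close>. If two global minimizers with the same support both have
  residual \<open>\<sigma>\<close>, so does their midpoint, hence by strict convexity they differ by an element of the
  kernel; moving along it kills a coordinate, which contradicts optimality. So a minimizer is
  determined by its support. A finite set has isolated points, and a global minimizer with residual
  below \<open>\<sigma>\<close> can be rescaled slightly without changing its support.\<close>

section \<open>Attained minima, support size and sparse least squares\<close>

lemma min_val_LeastI:
  assumes "x \<in> S" "\<And>y. y \<in> S \<Longrightarrow> g x \<le> g y"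
  shows "min_val g S = g x"
  unfolding min_val_def by (rule Least_equality) (use assms in auto)

lemma min_val_wellorder:
  fixes g :: "'a \<Rightarrow> 'b::wellorder"
  assumes "S \<noteq> {}"
  shows "min_val g S \<in> g ` S" and "x \<in> S \<Longrightarrow> min_val g S \<le> g x"
  unfolding min_val_def using assms by (auto intro: LeastI Least_le)

lemma argmin_set_iff: "x \<in> argmin_set g S \<longleftrightarrow> x \<in> S \<and> (\<forall>y\<in>S. g x \<le> g y)"
  by (auto simp: argmin_set_def is_arg_min_linorder)

lemma l0_mono: "(\<And>i. x $ i \<noteq> 0 \<Longrightarrow> y $ i \<noteq> 0) \<Longrightarrow> l0 x \<le> l0 y"
  unfolding l0_def by (rule card_mono) auto

lemma l0_less: "(\<And>i. x $ i \<noteq> 0 \<Longrightarrow> y $ i \<noteq> 0) \<Longrightarrow> x $ j = 0 \<Longrightarrow> y $ j \<noteq> 0 \<Longrightarrow> l0 x < l0 y"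
  unfolding l0_def by (rule psubset_card_mono) auto

lemma l0_eq_0_iff: "l0 x = 0 \<longleftrightarrow> x = 0"
  by (auto simp: l0_def vec_eq_iff)

lemma l0_scaleR: "c \<noteq> 0 \<Longrightarrow> l0 (c *\<^sub>R x) = l0 x"
  by (simp add: l0_def)

text \<open>The \<open>k\<close>-sparse vectors form a finite union of coordinate subspaces, whose
  images under \<open>A\<close> are subspaces and hence closed. Working in the image avoids sublevel
  sets, which are unbounded if \<open>A\<close> has a kernel.\<close>

lemma sparse_least_residual_attained:
  fixes A :: "real ^ 'n ^ 'm"
  obtains x where "l0 x \<le> k" "\<And>y. l0 y \<le> k \<Longrightarrow> norm (A *v x - b) \<le> norm (A *v y - b)"
proof -
  define V where "V T = {x :: real ^ 'n. \<forall>i. x $ i \<noteq> 0 \<longrightarrow> i \<in> T}" for T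
  have "closed ((*v) A ` V T)" for T
  proof (intro closed_subspace linear_subspace_image matrix_vector_mul_linear)
    show "subspace (V T)"
      by (rule subspaceI) (auto simp: V_def, metis add_0)
  qed
  moreover have "{x. l0 x \<le> k} = (\<Union>T\<in>{T. card T \<le> k}. V T)"
  proof (intro set_eqI iffI)
    fix x assume "x \<in> (\<Union>T\<in>{T. card T \<le> k}. V T)"
    then obtain T where "card T \<le> k" "{i. x $ i \<noteq> 0} \<subseteq> T"
      by (auto simp: V_def)
    then show "x \<in> {x. l0 x \<le> k}"
      using card_mono[of T "{i. x $ i \<noteq> 0}"] by (simp add: l0_def)
  qed (auto simp: V_def l0_def)
  ultimately have "closed ((*v) A ` {x. l0 x \<le> k})"
    by (simp add: image_UN closed_UN)
  moreover have "(*v) A ` {x. l0 x \<le> k} \<noteq> {}"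
    using l0_eq_0_iff[of "0 :: real ^ 'n"] by (auto intro!: exI[of _ "0 :: real ^ 'n"])
  ultimately obtain z where "z \<in> (*v) A ` {x. l0 x \<le> k}"
    "\<And>y. y \<in> (*v) A ` {x. l0 x \<le> k} \<Longrightarrow> dist b z \<le> dist b y"
    using distance_attains_inf[where a = b] by blast
  then obtain x where "l0 x \<le> k" "\<And>y. l0 y \<le> k \<Longrightarrow> dist b (A *v x) \<le> dist b (A *v y)"
    by blast
  then show ?thesis
    using that[of x] by (simp add: dist_norm norm_minus_commute)
qed

lemma least_residual_attained:
  fixes A :: "real ^ 'n ^ 'm"
  obtains x where "\<And>y. norm (A *v x - b) \<le> norm (A *v y - b)"
proof -
  have *: "l0 x \<le> CARD('n)" for x :: "real ^ 'n"
    by (simp add: l0_def card_mono)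
  obtain x where
    "\<And>y. l0 y \<le> CARD('n) \<Longrightarrow> norm (A *v x - b) \<le> norm (A *v y - b)"
    using sparse_least_residual_attained[of "CARD('n)" A b] by metis
  then show ?thesis
    using that * by metis
qed

section \<open>The iteration for the residual norm\<close>

declare iter_rho.simps [simp del] iter_s.simps [simp del]

context
  fixes A :: "real ^ 'n ^ 'm" and b :: "real ^ 'm" and f :: "real ^ 'n \<Rightarrow> real"
  assumes f: "f = (\<lambda>x. norm (A *v x - b))"
begin

lemma iter_rho_0: "iter_rho f 0 \<in> range f" "iter_rho f 0 \<le> f y"
proof -
  obtain x where x: "\<And>y. f x \<le> f y"
    using least_residual_attained[of A b] f by metis
  then have "iter_rho f 0 = f x"
    by (simp add: iter_rho.simps min_val_LeastI)
  then show "iter_rho f 0 \<in> range f" "iter_rho f 0 \<le> f y"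
    using x by auto
qed

lemma iter_rho_Suc:
  "iter_rho f (Suc i) \<in> f ` {x. l0 x \<le> iter_s f i - 1}"
  "l0 y \<le> iter_s f i - 1 \<Longrightarrow> iter_rho f (Suc i) \<le> f y"
proof -
  obtain x where x: "l0 x \<le> iter_s f i - 1" "\<And>y. l0 y \<le> iter_s f i - 1 \<Longrightarrow> f x \<le> f y"
    using sparse_least_residual_attained[of "iter_s f i - 1" A b] f by metis
  have "iter_rho f (Suc i) = f x"
    unfolding iter_rho.simps using x by (intro min_val_LeastI) auto
  then show "iter_rho f (Suc i) \<in> f ` {x. l0 x \<le> iter_s f i - 1}"
    "l0 y \<le> iter_s f i - 1 \<Longrightarrow> iter_rho f (Suc i) \<le> f y"
    using x by auto
qed

lemma iter_s_attained:
  obtains x where "f x = iter_rho f i" "l0 x = iter_s f i"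
proof -
  have "iter_rho f i \<in> range f"
    using iter_rho_0(1) iter_rho_Suc(1) by (cases i) blast+
  then have "{x. f x = iter_rho f i} \<noteq> {}"
    by fastforce
  then have "iter_s f i \<in> l0 ` {x. f x = iter_rho f i}"
    unfolding iter_s.simps by (rule min_val_wellorder)
  then show ?thesis
    using that by auto
qed

lemma iter_s_le: "f x = iter_rho f i \<Longrightarrow> iter_s f i \<le> l0 x"
  unfolding iter_s.simps by (rule min_val_wellorder) auto

lemma iter_s_Suc_le: "iter_s f (Suc i) \<le> iter_s f i - 1"
proof -
  obtain x where "f x = iter_rho f (Suc i)" "l0 x \<le> iter_s f i - 1"
    using iter_rho_Suc(1)[of i] by force
  then show ?thesis
    using iter_s_le[of x "Suc i"] by linarith
qed

text \<open>Termination: the sparsity drops by at least one per round until it is 0, so the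
  \<open>LEAST\<close> in \<open>iter_L\<close> ranges over a nonempty set.\<close>

lemma iter_s_iter_L: "iter_s f (iter_L f) = 0"
proof -
  have "iter_s f i \<le> iter_s f 0 - i" for i
  proof (induction i)
    case (Suc i)
    then show ?case
      using iter_s_Suc_le[of i] by linarith
  qed simp
  from this[of "iter_s f 0"] have "iter_s f (iter_s f 0) = 0"
    by simp
  then show ?thesis
    unfolding iter_L_def by (rule LeastI)
qed

text \<open>Core of (i) \<Longrightarrow> (ii). For \<open>k > 0\<close>, a sparsest point of
  residual \<open>iter_rho f k\<close> already obeys the sparsity bound of the problem that defines
  \<open>iter_rho f k\<close>, so \<open>x\<close> competes in that problem.\<close>

lemma residual_ge_if_iter_rho:
  assumes "f y = iter_rho f k" "l0 x \<le> l0 y" "\<And>z. f z = iter_rho f k \<Longrightarrow> l0 y \<le> l0 z"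
  shows "iter_rho f k \<le> f x"
proof (cases k)
  case 0
  then show ?thesis
    using iter_rho_0 by simp
next
  case (Suc j)
  obtain z where "f z = iter_rho f k" "l0 z = iter_s f k"
    by (rule iter_s_attained)
  then have "l0 x \<le> iter_s f j - 1"
    using assms iter_s_Suc_le[of j] Suc by force
  then show ?thesis
    using iter_rho_Suc(2) Suc by simp
qed

lemma iter_rho_hits:
  assumes x: "x \<in> argmin_set l0 {x. f x \<le> \<sigma>}" "x \<noteq> 0"
    and eq: "\<And>y. y \<in> argmin_set l0 {x. f x \<le> \<sigma>} \<Longrightarrow> f y = \<sigma>"
  shows "\<exists>k<iter_L f. iter_rho f k = \<sigma>"
proof (rule ccontr)
  assume no: "\<not> (\<exists>k<iter_L f. iter_rho f k = \<sigma>)"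
  have fx: "f x \<le> \<sigma>" and min: "\<And>y. f y \<le> \<sigma> \<Longrightarrow> l0 x \<le> l0 y"
    using x by (auto simp: argmin_set_iff)
  have s_ge: "l0 x \<le> iter_s f i" if "iter_rho f i \<le> \<sigma>" for i
    using iter_s_attained[of i] min that by metis
  have "i \<le> iter_L f \<Longrightarrow> iter_rho f i \<le> \<sigma>" for i
  proof (induction i)
    case 0
    then show ?case
      using iter_rho_0(2)[of x] fx by linarith
  next
    case (Suc i)
    then have rho: "iter_rho f i \<le> \<sigma>" "iter_rho f i \<noteq> \<sigma>"
      using no by auto
    obtain z where z: "f z = iter_rho f i" "l0 z = iter_s f i"
      by (rule iter_s_attained)
    \<comment> \<open>Otherwise \<open>z\<close> would be a global minimizer with residual below
      \<sigma>. So \<open>x\<close> is admissible in the next round, which keeps the next \<rho>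
      below \<open>f x\<close>.\<close>
    have "iter_s f i \<noteq> l0 x"
      using eq[of z] min z rho by (auto simp: argmin_set_iff)
    then have "l0 x \<le> iter_s f i - 1"
      using s_ge[OF rho(1)] by linarith
    from iter_rho_Suc(2)[OF this] show ?case
      using fx by linarith
  qed
  from s_ge[OF this[OF order_refl]] have "l0 x = 0"
    using iter_s_iter_L by simp
  then show False
    using x by (simp add: l0_eq_0_iff)
qed

end

section \<open>Supports, isolation and rescaling of global minimizers\<close>

lemma argmin_support_inj:
  fixes A :: "real ^ 'n ^ 'm" and b :: "real ^ 'm" and \<sigma> :: real
  defines "M \<equiv> argmin_set l0 {x. norm (A *v x - b) \<le> \<sigma>}"
  assumes eq: "\<And>x. x \<in> M \<Longrightarrow> norm (A *v x - b) = \<sigma>"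
  shows "inj_on (\<lambda>x. {i. x $ i \<noteq> 0}) M"
proof (rule inj_onI, rule ccontr)
  fix x y assume xy: "x \<in> M" "y \<in> M" "{i. x $ i \<noteq> 0} = {i. y $ i \<noteq> 0}" "x \<noteq> y"
  have supp: "x $ i = 0 \<longleftrightarrow> y $ i = 0" for i
    using xy(3) by blast
  have min: "l0 x \<le> l0 z" if "norm (A *v z - b) \<le> \<sigma>" for z
    using that xy(1) by (auto simp: M_def argmin_set_iff)
  have in_M: "z \<in> M" if "norm (A *v z - b) \<le> \<sigma>" "l0 z \<le> l0 x" for z
    using that min order.trans unfolding M_def argmin_set_iff by blast
  define z where "z = (1/2) *\<^sub>R (x + y)"
  define u where "u = A *v x - b"
  define w where "w = A *v y - b"
  have "A *v z - b = (1/2) *\<^sub>R (u + w)"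
    unfolding z_def u_def w_def
    by (simp add: matrix_vector_mult_scaleR matrix_vector_right_distrib vec_eq_iff field_simps)
  then have norm_z: "norm (A *v z - b) = norm (u + w) / 2"
    by simp
  have norms: "norm u = \<sigma>" "norm w = \<sigma>"
    using eq xy by (auto simp: u_def w_def)
  then have "norm (A *v z - b) \<le> \<sigma>"
    using norm_z norm_triangle_ineq[of u w] by linarith
  moreover have "l0 z \<le> l0 x"
    by (rule l0_mono) (auto simp: z_def supp)
  \<comment> \<open>The midpoint is itself a global minimizer, so its residual is exactly \<sigma>:
    equality in the triangle inequality.\<close>
  ultimately have "norm (u + w) = norm u + norm w"
    using eq[OF in_M] norm_z norms by fastforce
  then have "norm u *\<^sub>R w = norm w *\<^sub>R u"
    by (simp add: norm_triangle_eq)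
  then have "u = w"
    using norms by (cases "\<sigma> = 0") auto
  then have ker: "A *v y = A *v x"
    by (simp add: u_def w_def)
  obtain j where j: "x $ j \<noteq> y $ j"
    using xy(4) by (auto simp: vec_eq_iff)
  \<comment> \<open>The coefficient makes coordinate \<open>j\<close> vanish. The support cannot
    grow, as \<open>x\<close> and \<open>y\<close> share it, and \<open>x $ j\<close> is nonzero,
    since otherwise \<open>x\<close> and \<open>y\<close> would agree at \<open>j\<close>.\<close>
  define v where "v = x - (x $ j / (y $ j - x $ j)) *\<^sub>R (y - x)"
  have "A *v v = A *v x"
    unfolding v_def by (simp add: matrix_vector_mult_diff_distrib matrix_vector_mult_scaleR ker)
  then have "l0 x \<le> l0 v"
    using min eq xy(1) by simp
  moreover have "l0 v < l0 x"
  proof (rule l0_less)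
    show "x $ i \<noteq> 0" if "v $ i \<noteq> 0" for i
      using that supp[of i] by (auto simp: v_def)
    show "v $ j = 0" "x $ j \<noteq> 0"
      using j supp[of j] by (auto simp: v_def)
  qed
  ultimately show False
    by simp
qed

lemma strict_minimizer_if_finite_argmin:
  fixes g :: "real ^ 'd \<Rightarrow> 'b::linorder"
  assumes "finite (argmin_set g S)" "x \<in> argmin_set g S"
  shows "strict_minimizer g S x"
proof -
  obtain d where d: "d > 0" "\<And>y. y \<in> argmin_set g S \<Longrightarrow> y \<noteq> x \<Longrightarrow> d \<le> dist x y"
    using finite_set_avoid[OF assms(1), of x] by blast
  \<comment> \<open>Other minimizers may lie at distance exactly \<open>d\<close>; halving the
    radius excludes them from the closed ball.\<close>
  have "g x < g y" if y: "y \<in> cball x (d/2) \<inter> S" "y \<noteq> x" for y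
  proof (rule ccontr)
    assume "\<not> g x < g y"
    then have "y \<in> argmin_set g S"
      using y assms(2) unfolding argmin_set_iff by (meson IntD2 linorder_not_less order.trans)
    then show False
      using d y by fastforce
  qed
  then show ?thesis
    unfolding strict_minimizer_def using d(1) by (intro exI[of _ "d/2"]) auto
qed

lemma residual_if_strict_minimizer:
  fixes A :: "real ^ 'n ^ 'm"
  assumes strict: "strict_minimizer l0 {x. norm (A *v x - b) \<le> \<sigma>} x"
    and "norm (A *v x - b) \<le> \<sigma>" "x \<noteq> 0"
  shows "norm (A *v x - b) = \<sigma>"
proof (rule ccontr)
  assume "norm (A *v x - b) \<noteq> \<sigma>"
  then have less: "norm (A *v x - b) < \<sigma>"
    using assms by simp
  obtain d where d: "d > 0"
    "\<And>y. y \<in> cball x d \<Longrightarrow> norm (A *v y - b) \<le> \<sigma> \<Longrightarrow> y \<noteq> x \<Longrightarrow> l0 x < l0 y"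
    using strict by (auto simp: strict_minimizer_def)
  have "((\<lambda>t. norm (t *\<^sub>R (A *v x) - b)) \<longlongrightarrow> norm (1 *\<^sub>R (A *v x) - b)) (at_right (1::real))"
    by (intro tendsto_intros)
  then have "\<forall>\<^sub>F t in at_right 1. norm (t *\<^sub>R (A *v x) - b) < \<sigma>"
    using less by (intro order_tendstoD) auto
  moreover have "((\<lambda>t. dist x (t *\<^sub>R x)) \<longlongrightarrow> dist x (1 *\<^sub>R x)) (at_right (1::real))"
    by (intro tendsto_intros)
  then have "\<forall>\<^sub>F t in at_right 1. dist x (t *\<^sub>R x) < d"
    using d(1) by (intro order_tendstoD) auto
  \<comment> \<open>\<open>t > 1\<close> gives both \<open>t \<noteq> 0\<close>, which preserves the
    support, and \<open>t *\<^sub>R x \<noteq> x\<close>.\<close>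
  moreover have "\<forall>\<^sub>F t in at_right (1::real). t > 1"
    by (rule eventually_at_right_less)
  ultimately have "\<forall>\<^sub>F t in at_right (1::real). False"
  proof eventually_elim
    case (elim t)
    then have "l0 x < l0 (t *\<^sub>R x)"
      using \<open>x \<noteq> 0\<close> scaleR_cancel_right[of t x 1] by (intro d) (auto simp: matrix_vector_mult_scaleR)
    then show False
      using elim by (simp add: l0_scaleR)
  qed
  then show False
    by simp
qed

theorem theorem6p6:
  fixes A :: "real ^ 'n ^ 'm" and b :: "real ^ 'm" and \<phi> :: "real \<Rightarrow> real"
    and f :: "real ^ 'n \<Rightarrow> real" and \<sigma> :: real
    and feasible Omega_hat :: "(real ^ 'n) set"
  assumes phi: "\<And>z. z \<ge> 0 \<Longrightarrow> \<phi> z = z"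
    and f: "f = (\<lambda>x. \<phi> (norm (A *v x - b)))"
    and sigma: "\<sigma> \<in> {min_val (\<lambda>x. norm (A *v x - b)) UNIV ..< norm b}"
    and feasible: "feasible = {x. norm (A *v x - b) \<le> \<sigma>}"
    and Omega_hat: "Omega_hat = argmin_set l0 feasible"
  shows "((\<exists>k<iter_L f. iter_rho f k = \<sigma>) \<longleftrightarrow> (\<forall>x\<in>Omega_hat. norm (A *v x - b) = \<sigma>)) \<and>
         ((\<forall>x\<in>Omega_hat. norm (A *v x - b) = \<sigma>) \<longleftrightarrow>
            (\<forall>x\<in>Omega_hat. strict_minimizer l0 feasible x)) \<and>
         ((\<forall>x\<in>Omega_hat. strict_minimizer l0 feasible x) \<longleftrightarrow> finite Omega_hat)"
proof -
  have f': "f = (\<lambda>x. norm (A *v x - b))"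
    using phi f by simp
  have Omega_f: "Omega_hat = argmin_set l0 {x. f x \<le> \<sigma>}"
    by (simp add: Omega_hat feasible f')
  obtain x0 where x0: "\<And>y. norm (A *v x0 - b) \<le> norm (A *v y - b)"
    using least_residual_attained[of A b] by blast
  then have "x0 \<in> feasible"
    using sigma min_val_LeastI[of x0 UNIV "\<lambda>x. norm (A *v x - b)"] by (simp add: feasible)
  then have "min_val l0 feasible \<in> l0 ` feasible"
    "\<And>y. y \<in> feasible \<Longrightarrow> min_val l0 feasible \<le> l0 y"
    using min_val_wellorder[where S = feasible and g = l0] by blast+
  \<comment> \<open>A minimizer must exist, or (ii) would hold vacuously in
    \<open>ii_i\<close>.\<close>
  then obtain x where x: "x \<in> Omega_hat"
    unfolding Omega_hat argmin_set_iff by (metis imageE)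
  \<comment> \<open>The residual at 0 is \<open>norm b\<close>, which exceeds \<sigma>.\<close>
  have nonzero: "y \<noteq> 0" if "y \<in> Omega_hat" for y
    using that sigma by (auto simp: Omega_hat feasible argmin_set_iff)

  have i_ii: "\<forall>x\<in>Omega_hat. norm (A *v x - b) = \<sigma>" if k: "iter_rho f k = \<sigma>" for k
  proof
    fix z assume z: "z \<in> Omega_hat"
    obtain y where y: "f y = iter_rho f k" "l0 y = iter_s f k"
      by (rule iter_s_attained[OF f'])
    \<comment> \<open>\<open>y\<close> is feasible because its residual is \<sigma>, and
      \<open>z\<close> is optimal.\<close>
    have "l0 z \<le> l0 y"
      using z k y(1) by (simp add: Omega_f argmin_set_iff)
    then have "\<sigma> \<le> f z"
      using residual_ge_if_iter_rho[OF f' y(1)] iter_s_le[OF f', of _ k] y k by simp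
    then show "norm (A *v z - b) = \<sigma>"
      using z f' by (simp add: Omega_hat feasible argmin_set_iff)
  qed
  have ii_i: "\<exists>k<iter_L f. iter_rho f k = \<sigma>" if "\<forall>x\<in>Omega_hat. norm (A *v x - b) = \<sigma>"
    using that x nonzero by (intro iter_rho_hits[OF f', of x]) (auto simp: f' Omega_hat feasible)
  have ii_iv: "finite Omega_hat" if "\<forall>x\<in>Omega_hat. norm (A *v x - b) = \<sigma>"
    using argmin_support_inj[of A b \<sigma>] that unfolding Omega_hat feasible
    by (intro finite_imageD[where f = "\<lambda>x. {i. x $ i \<noteq> 0}"]) auto
  have iv_iii: "\<forall>x\<in>Omega_hat. strict_minimizer l0 feasible x" if "finite Omega_hat"
    using that strict_minimizer_if_finite_argmin unfolding Omega_hat by blast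
  have iii_ii: "\<forall>x\<in>Omega_hat. norm (A *v x - b) = \<sigma>"
    if "\<forall>x\<in>Omega_hat. strict_minimizer l0 feasible x"
    using that nonzero residual_if_strict_minimizer[of A b \<sigma>]
    by (auto simp: Omega_hat feasible argmin_set_iff)
  show ?thesis
    using i_ii ii_i ii_iv iv_iii iii_ii by blast
qed

end
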